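(* Let $G,H,K$ be finite abelian groups with conjugate groups $G',H',K'$. If $M(G')=M(H')M(K')$ is a SNF factorisation, then $G= H\oplus K$ is a direct factorisation; and conversely, if $G= H\oplus K$ is a direct factorisation, then $M(G')=M(H')M(K')$ is a SNF factorisation.
   Context: Groups are considered up to isomorphism, so that "$G=H\oplus K$ is a direct factorisation" means $G\cong H\oplus K$ (equivalently $G$ is the sum of two subgroups, isomorphic to $H$ and $K$, with trivial intersection). Smith normal form (SNF): a diagonal integer matrix $\mathrm{diag}[n_1,n_1n_2,\dots,n_1n_2\cdots n_r]$ with positive integers $n_i$ (each diagonal entry divides the next). To a finite abelian group $G\cong \mathbb Z/n_1\mathbb Z\oplus\mathbb Z/n_1n_2\mathbb Z\oplus\cdots\oplus\mathbb Z/n_1\cdots n_r\mathbb Z$ one associates $M(G)=\mathrm{diag}[n_1,n_1n_2,\dots,n_1\cdots n_r]$. Leading entries equal to $1$ are allowed, so $M(G)$ can be written as an $r\times r$ matrix for any $r$ at least the rank (minimal number of generators) of $G$; in a product $M(G')=M(H')M(K')$ all matrices are taken of the same common size. A SNF factorisation of a SNF matrix $S$ is a decomposition of $S$ as a product of SNF matrices. Conjugate group: for a prime $p$ and a finite abelian $p$-group $G\cong \mathbb Z/p^{a_1}\mathbb Z\oplus\cdots\oplus\mathbb Z/p^{a_r}\mathbb Z$ with $0\le a_1\le\cdots\le a_r$, the type of $G$ is the partition $\lambda=(a_1,\dots,a_r)$, and the conjugate $G'$ of $G$ is the finite abelian $p$-group whose type is the conjugate (transposed) partition $\lambda'$. For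 a general finite abelian group, $G'$ is the direct sum of the conjugates of its $p$-primary components. *)

theory Defs
  imports "HOL-Algebra.Product_Groups" "HOL-Computational_Algebra.Primes"
    "Jordan_Normal_Form.Matrix"
begin

section \<open>Smith normal forms\<close>

text \<open>
  A list \<open>[n\<^sub>1, \<dots>, n\<^sub>r]\<close> of positive integers determines the invariant factors
  \<open>n\<^sub>1, n\<^sub>1n\<^sub>2, \<dots>, n\<^sub>1\<cdots>n\<^sub>r\<close>. Positions are counted from \<open>0\<close>.
\<close>

definition invariant_factor :: "nat list \<Rightarrow> nat \<Rightarrow> nat" where
  "invariant_factor ns i = (\<Prod>j\<le>i. ns ! j)"

definition invariant_factor_mat :: "nat list \<Rightarrow> int mat" where
  "invariant_factor_mat ns = mat_diag (length ns) (\<lambda>i. int (invariant_factor ns i))"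

definition invariant_factor_group :: "nat list \<Rightarrow> (nat \<Rightarrow> int) monoid" where
  "invariant_factor_group ns =
     product_group {..<length ns} (\<lambda>i. integer_mod_group (invariant_factor ns i))"

definition smith_normal_form :: "int mat \<Rightarrow> bool" where
  "smith_normal_form S \<longleftrightarrow> (\<exists>ns. (\<forall>n\<in>set ns. 0 < n) \<and> S = invariant_factor_mat ns)"

text \<open>
  \<open>is_smith_matrix_of r G S\<close> says that \<open>S\<close> is \<open>M(G)\<close>, written as an \<open>r \<times> r\<close> matrix. Leading
  entries may be \<open>1\<close>, so for a finite abelian group such an \<open>S\<close> exists precisely if \<open>r\<close> is at
  least the minimal number of generators of \<open>G\<close>; it is then unique.
\<close>

definition is_smith_matrix_of :: "nat \<Rightarrow> ('a, 'm) monoid_scheme \<Rightarrow> int mat \<Rightarrow> bool" where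
  "is_smith_matrix_of r G S \<longleftrightarrow>
     (\<exists>ns. length ns = r \<and> (\<forall>n\<in>set ns. 0 < n) \<and>
           G \<cong> invariant_factor_group ns \<and> S = invariant_factor_mat ns)"

definition snf_factorisation :: "int mat \<Rightarrow> int mat list \<Rightarrow> bool" where
  "snf_factorisation S As \<longleftrightarrow>
     smith_normal_form S \<and>
     (\<forall>A\<in>set As. smith_normal_form A \<and> dim_row A = dim_row S) \<and>
     S = foldr (*) As (1\<^sub>m (dim_row S))"


section \<open>Conjugate groups\<close>

text \<open>
  Partitions are weakly increasing lists of natural numbers, in which zeros are allowed.
\<close>

definition abelian_p_group :: "nat \<Rightarrow> nat list \<Rightarrow> (nat \<Rightarrow> int) monoid" where
  "abelian_p_group p as = product_group {..<length as} (\<lambda>i. integer_mod_group (p ^ (as ! i)))"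

definition has_type :: "nat \<Rightarrow> ('a, 'm) monoid_scheme \<Rightarrow> nat list \<Rightarrow> bool" where
  "has_type p G as \<longleftrightarrow> sorted as \<and> G \<cong> abelian_p_group p as"

text \<open>
  The \<open>j\<close>-th part of the transposed partition is the number of parts that are at least \<open>j\<close>, for
  \<open>j\<close> from \<open>1\<close> to the largest part. These numbers decrease with \<open>j\<close>, hence the reversal.
\<close>

definition conjugate_partition :: "nat list \<Rightarrow> nat list" where
  "conjugate_partition as =
     rev (map (\<lambda>j. length (filter (\<lambda>a. j \<le> a) as)) [1..<Suc (Max (set (0 # as)))])"

lemma sorted_conjugate_partition: "sorted (conjugate_partition as)"
proof -
  have "length (filter (\<lambda>a. k \<le> a) as) \<le> length (filter (\<lambda>a. j \<le> a) as)" if "j \<le> k" for j k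
    using that by (induction as) auto
  then show ?thesis
    unfolding conjugate_partition_def sorted_wrt_rev sorted_wrt_map
    by (intro sorted_wrt_mono_rel[OF _ sorted_upt]) auto
qed

lemma conjugate_partition_example: "conjugate_partition [0, 1, 2, 4] = [1, 1, 2, 3]"
  by (simp add: conjugate_partition_def upt_rec)

definition primary_component :: "nat \<Rightarrow> ('a, 'm) monoid_scheme \<Rightarrow> ('a, 'm) monoid_scheme" where
  "primary_component p G = G\<lparr>carrier := {x \<in> carrier G. \<exists>k::nat. x [^]\<^bsub>G\<^esub> (p ^ k) = \<one>\<^bsub>G\<^esub>}\<rparr>"

text \<open>
  \<open>is_conjugate_group G G'\<close>: up to isomorphism, \<open>G'\<close> is the direct sum over the primes \<open>p\<close> dividing
  the order of \<open>G\<close> of the conjugates of the \<open>p\<close>-primary components of \<open>G\<close>. Here \<open>t p\<close> is the type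
  of the \<open>p\<close>-primary component, so that its conjugate is the \<open>p\<close>-group of type
  \<open>conjugate_partition (t p)\<close>. As everything is taken up to isomorphism, this is a relation.
\<close>

definition is_conjugate_group :: "('a, 'm) monoid_scheme \<Rightarrow> ('b, 'n) monoid_scheme \<Rightarrow> bool" where
  "is_conjugate_group G G' \<longleftrightarrow>
     (let P = {p. prime p \<and> p dvd order G} in
      \<exists>t. (\<forall>p\<in>P. has_type p (primary_component p G) (t p)) \<and>
          G' \<cong> product_group P (\<lambda>p. abelian_p_group p (conjugate_partition (t p))))"

end

theory Submission
  imports Defs "HOL-Algebra.Multiplicative_Group"
    "HOL-Number_Theory.Prime_Powers"
begin

text \<open>
  A finite abelian group \<open>G\<close> is determined by the numbers of solutions of \<open>x\<^sup>n = 1\<close> for prime powers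
  \<open>n\<close>, and these numbers are multiplicative on direct products. For \<open>n = p ^ k\<close> the number is
  \<open>p ^ (g 0 + \<dots> + g (k - 1))\<close>, where \<open>g j\<close> counts the parts greater than \<open>j\<close> in the type of the
  \<open>p\<close>-primary component of \<open>G\<close>. The \<open>g j\<close> are the parts of the transposed partition, that is, the
  exponents of \<open>p\<close> in the invariant factors of the conjugate group \<open>G'\<close>, starting from the last.
  So both sides of the equivalence say that these exponents for \<open>H\<close> and \<open>K\<close> add up to those for \<open>G\<close>.
\<close>

section \<open>Isomorphisms between products of groups\<close>

lemma product_group_reindex:
  assumes "bij_betw h I J" and "\<And>i. i \<in> I \<Longrightarrow> F i = E (h i)"
  shows "product_group J E \<cong> product_group I F"
proof -
  let ?f = "\<lambda>x. \<lambda>i\<in>I. x (h i)"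
  let ?g = "\<lambda>y. \<lambda>j\<in>J. y (inv_into I h j)"
  have hJ: "h i \<in> J" if "i \<in> I" for i
    using assms(1) that by (rule bij_betwE[THEN bspec])
  have hI: "inv_into I h j \<in> I" "h (inv_into I h j) = j" if "j \<in> J" for j
    using assms(1) that by (simp_all add: bij_betw_def inv_into_into f_inv_into_f)
  have inv: "inv_into I h (h i) = i" if "i \<in> I" for i
    using assms(1) that by (simp add: bij_betw_def inv_into_f_f)
  have F: "y (inv_into I h j) \<in> carrier (E j)" if "j \<in> J" "\<forall>i\<in>I. y i \<in> carrier (E (h i))" for y j
    using bspec[OF that(2) hI(1)[OF that(1)]] hI(2)[OF that(1)] by simp
  have "?f \<in> hom (product_group J E) (product_group I F)"
    by (rule homI) (auto simp: assms(2) hJ)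
  moreover have "bij_betw ?f (carrier (product_group J E)) (carrier (product_group I F))"
    by (rule bij_betw_byWitness[where f' = ?g])
      (auto simp: hJ hI inv F assms(2) fun_eq_iff PiE_iff extensional_def)
  ultimately show ?thesis
    by (blast intro: is_isoI isoI)
qed

text \<open>Currying. It flattens a product over primes of products of cyclic groups into a single
  product indexed by pairs.\<close>

lemma product_group_Sigma:
  "product_group (Sigma I J) (\<lambda>(i, j). F i j) \<cong> product_group I (\<lambda>i. product_group (J i) (F i))"
proof -
  let ?f = "\<lambda>x. \<lambda>i\<in>I. \<lambda>j\<in>J i. x (i, j)"
  let ?g = "\<lambda>y. \<lambda>(i, j)\<in>Sigma I J. y i j"
  let ?A = "product_group (Sigma I J) (\<lambda>(i, j). F i j)"
    and ?B = "product_group I (\<lambda>i. product_group (J i) (F i))"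
  have "?f \<in> hom ?A ?B"
    by (rule homI) (auto simp: PiE_iff fun_eq_iff)
  moreover have "bij_betw ?f (carrier ?A) (carrier ?B)"
  proof (rule bij_betw_byWitness[where f' = ?g])
    show "\<forall>x\<in>carrier ?A. ?g (?f x) = x"
      by (auto simp: PiE_iff fun_eq_iff extensional_def)
    show "\<forall>y\<in>carrier ?B. ?f (?g y) = y"
      by (simp add: PiE_iff fun_eq_iff extensional_def)
    show "?f ` carrier ?A \<subseteq> carrier ?B"
      by (auto simp: PiE_iff)
    show "?g ` carrier ?B \<subseteq> carrier ?A"
      by (auto simp: PiE_iff extensional_def split: if_splits)
  qed
  ultimately show ?thesis
    by (blast intro: is_isoI isoI)
qed

lemma product_group_Plus:
  "product_group (I <+> J) (case_sum E F) \<cong> product_group I E \<times>\<times> product_group J F"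
proof -
  let ?f = "\<lambda>x. (\<lambda>i\<in>I. x (Inl i), \<lambda>j\<in>J. x (Inr j))"
  let ?g = "\<lambda>(y, z). \<lambda>k\<in>I <+> J. case k of Inl i \<Rightarrow> y i | Inr j \<Rightarrow> z j"
  let ?A = "product_group (I <+> J) (case_sum E F)"
    and ?B = "product_group I E \<times>\<times> product_group J F"
  have l: "x (Inl i) \<in> carrier (E i)" if "x \<in> carrier ?A" "i \<in> I" for x i
    using PiE_mem[OF that(1)[unfolded carrier_product_group] InlI[OF that(2)]] by simp
  have r: "x (Inr j) \<in> carrier (F j)" if "x \<in> carrier ?A" "j \<in> J" for x j
    using PiE_mem[OF that(1)[unfolded carrier_product_group] InrI[OF that(2)]] by simp
  have fA: "?f x \<in> carrier ?B" if "x \<in> carrier ?A" for x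
    using l[OF that] r[OF that] by simp
  then have "?f \<in> hom ?A ?B"
    by (rule homI) (simp_all add: fun_eq_iff InlI InrI)
  moreover have "bij_betw ?f (carrier ?A) (carrier ?B)"
  proof (rule bij_betw_byWitness[where f' = ?g])
    show "\<forall>x\<in>carrier ?A. ?g (?f x) = x"
      by (auto simp: PiE_iff fun_eq_iff extensional_def split: sum.split)
    show "\<forall>y\<in>carrier ?B. ?f (?g y) = y"
      by (auto simp: fun_eq_iff PiE_iff extensional_def InlI InrI)
    show "?f ` carrier ?A \<subseteq> carrier ?B"
      using fA by blast
    show "?g ` carrier ?B \<subseteq> carrier ?A"
      by (auto simp: PiE_iff Plus_def split: if_splits)
  qed
  ultimately show ?thesis
    by (blast intro: is_isoI isoI)
qed

text \<open>Restriction to \<open>J\<close> loses nothing, because a coordinate in a trivial group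
  can only be the identity. It serves to discard the factors of order \<open>p ^ 0\<close> that come
  from zero parts of a type.\<close>

lemma product_group_drop_trivial:
  assumes grp: "\<And>i. i \<in> I \<Longrightarrow> group (F i)" and sub: "J \<subseteq> I"
    and triv: "\<And>i. i \<in> I - J \<Longrightarrow> trivial_group (F i)"
  shows "product_group I F \<cong> product_group J F"
proof -
  let ?f = "\<lambda>x. \<lambda>i\<in>J. x i"
  let ?g = "\<lambda>y. \<lambda>i\<in>I. if i \<in> J then y i else \<one>\<^bsub>F i\<^esub>"
  have car: "carrier (F i) = {\<one>\<^bsub>F i\<^esub>}" if "i \<in> I" "i \<notin> J" for i
    using triv that by (simp add: trivial_group_def)
  have one: "\<one>\<^bsub>F i\<^esub> \<in> carrier (F i)" if "i \<in> I" for i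
    using grp that by (simp add: group.is_monoid monoid.one_closed)
  have "?f \<in> hom (product_group I F) (product_group J F)"
    using sub by (intro homI) (auto simp: fun_eq_iff PiE_iff)
  moreover have "bij_betw ?f (carrier (product_group I F)) (carrier (product_group J F))"
  proof (rule bij_betw_byWitness[where f' = ?g])
    show "\<forall>x\<in>carrier (product_group I F). ?g (?f x) = x"
      using car by (fastforce simp: fun_eq_iff PiE_iff extensional_def)
    show "\<forall>y\<in>carrier (product_group J F). ?f (?g y) = y"
      using sub by (auto simp: fun_eq_iff PiE_iff extensional_def)
    show "?f ` carrier (product_group I F) \<subseteq> carrier (product_group J F)"
      using sub by auto
    show "?g ` carrier (product_group J F) \<subseteq> carrier (product_group I F)"
      using sub one by (auto simp: PiE_iff)
  qed
  ultimately show ?thesis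
    by (blast intro: is_isoI isoI)
qed

lemma DirProd_is_iso_cong:
  assumes "group G" "group H" "G \<cong> G2" "H \<cong> H2"
  shows "G \<times>\<times> H \<cong> G2 \<times>\<times> H2"
proof -
  obtain f g where "f \<in> iso G G2" "g \<in> iso H H2"
    using assms by (auto simp: is_iso_def)
  then have "(\<lambda>(x, y). (f x, g y)) \<in> iso (G \<times>\<times> H) (G2 \<times>\<times> H2)"
    using assms by (simp add: iso_paired2)
  then show ?thesis
    by (rule is_isoI)
qed

text \<open>Fibres of equal size over each value are in bijection, and as the fibres partition both
  sets, these bijections glue. It will match cyclic factors of equal order.\<close>

lemma exists_bij_betw_preserving:
  assumes "finite I" "finite J"
    and "\<And>v. card {i \<in> I. f i = v} = card {j \<in> J. g j = v}"
  shows "\<exists>h. bij_betw h I J \<and> (\<forall>i\<in>I. g (h i) = f i)"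
proof -
  have "\<exists>h. bij_betw h {i \<in> I. f i = v} {j \<in> J. g j = v}" for v
    using assms by (intro finite_same_card_bij) auto
  then obtain H where H: "bij_betw (H v) {i \<in> I. f i = v} {j \<in> J. g j = v}" for v
    by metis
  define h where "h i = H (f i) i" for i
  have h: "h i \<in> J" "g (h i) = f i" if "i \<in> I" for i
    using bij_betwE[OF H[of "f i"]] that by (auto simp: h_def)
  have "inj_on h I"
  proof (rule inj_onI)
    fix i j assume ij: "i \<in> I" "j \<in> I" "h i = h j"
    then have "f i = f j"
      using h(2)[of i] h(2)[of j] by simp
    with ij show "i = j"
      using bij_betw_imp_inj_on[OF H[of "f i"]] by (auto simp: h_def inj_on_def)
  qed
  moreover have "j \<in> h ` I" if "j \<in> J" for j
  proof -
    have "j \<in> H (g j) ` {i \<in> I. f i = g j}"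
      using bij_betw_imp_surj_on[OF H[of "g j"]] that by auto
    then obtain i where "i \<in> I" "f i = g j" "j = H (g j) i"
      by blast
    then show ?thesis
      unfolding h_def by (intro image_eqI[of _ _ i]) simp_all
  qed
  ultimately have "bij_betw h I J"
    using h by (auto simp: bij_betw_def)
  then show ?thesis
    using h(2) by (intro exI[of _ h] conjI ballI)
qed

section \<open>Counting torsion elements\<close>

definition torsion_count :: "('a, 'm) monoid_scheme \<Rightarrow> nat \<Rightarrow> nat" where
  "torsion_count G n = card {x \<in> carrier G. x [^]\<^bsub>G\<^esub> n = \<one>\<^bsub>G\<^esub>}"

lemma torsion_count_iso:
  assumes "group G" "group H" "G \<cong> H"
  shows "torsion_count G n = torsion_count H n"
proof -
  obtain h where h: "h \<in> iso G H"
    using assms(3) by (auto simp: is_iso_def)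
  then interpret group_hom G H h
    using assms(1,2) by (simp add: group_hom_def group_hom_axioms_def iso_iff)
  have bij: "bij_betw h (carrier G) (carrier H)"
    using h by (simp add: iso_def)
  have "h x [^]\<^bsub>H\<^esub> n = \<one>\<^bsub>H\<^esub> \<longleftrightarrow> x [^]\<^bsub>G\<^esub> n = \<one>\<^bsub>G\<^esub>" if "x \<in> carrier G" for x
    using that bij inj_on_eq_iff[of h "carrier G" "x [^]\<^bsub>G\<^esub> n" "\<one>\<^bsub>G\<^esub>"]
    by (simp add: hom_nat_pow[symmetric] bij_betw_def)
  then have "h ` {x \<in> carrier G. x [^]\<^bsub>G\<^esub> n = \<one>\<^bsub>G\<^esub>} = {y \<in> carrier H. y [^]\<^bsub>H\<^esub> n = \<one>\<^bsub>H\<^esub>}"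
    unfolding bij_betw_imp_surj_on[OF bij, symmetric] by blast
  then have "bij_betw h {x \<in> carrier G. x [^]\<^bsub>G\<^esub> n = \<one>\<^bsub>G\<^esub>} {y \<in> carrier H. y [^]\<^bsub>H\<^esub> n = \<one>\<^bsub>H\<^esub>}"
    by (intro bij_betw_subset[OF bij]) auto
  then show ?thesis
    unfolding torsion_count_def by (rule bij_betw_same_card)
qed

lemma torsion_count_product_group:
  assumes "finite I"
  shows "torsion_count (product_group I F) n = (\<Prod>i\<in>I. torsion_count (F i) n)"
proof -
  have pow: "x [^]\<^bsub>product_group I F\<^esub> n = (\<lambda>i\<in>I. x i [^]\<^bsub>F i\<^esub> n)"
    for x and n :: nat
    by (induction n) (auto simp: fun_eq_iff)
  have "{x \<in> carrier (product_group I F). x [^]\<^bsub>product_group I F\<^esub> n = \<one>\<^bsub>product_group I F\<^esub>} =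
      (\<Pi>\<^sub>E i\<in>I. {x \<in> carrier (F i). x [^]\<^bsub>F i\<^esub> n = \<one>\<^bsub>F i\<^esub>})"
    unfolding pow by (simp add: set_eq_iff PiE_iff fun_eq_iff) blast
  then show ?thesis
    using assms by (simp add: torsion_count_def card_PiE)
qed

lemma torsion_count_DirProd:
  "torsion_count (G \<times>\<times> H) n = torsion_count G n * torsion_count H n"
proof -
  have pow: "(x, y) [^]\<^bsub>G \<times>\<times> H\<^esub> n = (x [^]\<^bsub>G\<^esub> n, y [^]\<^bsub>H\<^esub> n)" for x y and n :: nat
    by (induction n) auto
  have "{z \<in> carrier (G \<times>\<times> H). z [^]\<^bsub>G \<times>\<times> H\<^esub> n = \<one>\<^bsub>G \<times>\<times> H\<^esub>} =
      {x \<in> carrier G. x [^]\<^bsub>G\<^esub> n = \<one>\<^bsub>G\<^esub>} \<times> {x \<in> carrier H. x [^]\<^bsub>H\<^esub> n = \<one>\<^bsub>H\<^esub>}"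
    by (auto simp: pow)
  then show ?thesis
    by (simp add: torsion_count_def card_cartesian_product)
qed

text \<open>With \<open>n = g * n'\<close>, \<open>m = g * m'\<close> and \<open>n'\<close>,
  \<open>m'\<close> coprime, the condition \<open>n dvd m * x\<close> reduces to
  \<open>n' dvd x\<close>, and exactly \<open>g\<close> multiples of \<open>n'\<close> lie between 0
  and \<open>n - 1\<close>.\<close>

lemma torsion_count_integer_mod_group:
  assumes "0 < n"
  shows "torsion_count (integer_mod_group n) m = gcd n m"
proof -
  define g where "g = gcd n m"
  have g: "0 < g"
    using assms by (simp add: g_def)
  obtain n' m' where n': "n = g * n'" "m = g * m'" and cop: "coprime n' m'"
    using gcd_coprime_exists[of n m] g unfolding g_def by (metis mult.commute not_gr0)
  have pos: "0 < n'"
    using assms n' by auto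
  have "{x \<in> carrier (integer_mod_group n). x [^]\<^bsub>integer_mod_group n\<^esub> m = \<one>\<^bsub>integer_mod_group n\<^esub>}
      = (\<lambda>i. int n' * i) ` {0..<int g}" (is "?L = ?R")
  proof (intro equalityI subsetI)
    fix x assume "x \<in> ?L"
    then have x: "0 \<le> x" "x < int n" "int n dvd int m * x"
      using assms by (auto simp: carrier_integer_mod_group mod_eq_0_iff_dvd)
    then have "int n' dvd int m' * x"
      using g by (simp add: n' mult.assoc)
    then have "int n' dvd x"
      using cop by (simp add: coprime_dvd_mult_right_iff)
    then obtain y where y: "x = int n' * y" ..
    with x pos have "0 \<le> y" "y < int g"
      by (auto simp: n' zero_le_mult_iff mult.commute)
    with y show "x \<in> ?R"
      by auto
  next
    fix x assume "x \<in> ?R"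
    then obtain y where y: "y \<in> {0..<int g}" "x = int n' * y"
      by blast
    then have "int m * x = int n * (int m' * y)"
      by (simp add: n')
    moreover from y pos have "0 \<le> x" "x < int n"
      by (simp_all add: n' mult.commute[of g])
    ultimately show "x \<in> ?L"
      using assms by (simp add: carrier_integer_mod_group)
  qed
  moreover have "inj_on (\<lambda>i. int n' * i) {0..<int g}"
    using pos by (auto simp: inj_on_def)
  ultimately show ?thesis
    by (simp add: torsion_count_def card_image g_def)
qed

section \<open>Primary decomposition\<close>

lemma (in group) pow_coprime_eq_one:
  fixes m n :: nat
  assumes "x \<in> carrier G" "x [^] m = \<one>" "x [^] n = \<one>" "coprime m n"
  shows "x = \<one>"
proof -
  have "ord x dvd m" "ord x dvd n"
    using assms by (simp_all add: pow_eq_id)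
  then have "is_unit (ord x)"
    using assms(4) by (blast intro: coprime_common_divisor)
  then show ?thesis
    using ord_eq_1[OF assms(1)] by simp
qed

lemma (in comm_group) finprod_pow_eq_one:
  assumes "finite A" "f \<in> A \<rightarrow> carrier G" "\<And>a. a \<in> A \<Longrightarrow> f a [^] (n::nat) = \<one>"
  shows "finprod G f A [^] n = \<one>"
  using assms
proof (induction A rule: finite_induct)
  case (insert a A)
  then have "f a \<in> carrier G" "finprod G f A \<in> carrier G" "f \<in> A \<rightarrow> carrier G"
    by (auto intro: finprod_closed)
  with insert show ?case
    by (simp add: nat_pow_distrib)
qed simp

lemma (in comm_group) primary_component_subgroup:
  "subgroup {x \<in> carrier G. \<exists>k::nat. x [^] (p ^ k :: nat) = \<one>} G"
proof (rule subgroupI)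
  fix x y
  assume x: "x \<in> {x \<in> carrier G. \<exists>k::nat. x [^] (p ^ k :: nat) = \<one>}"
  then obtain k :: nat where k: "x \<in> carrier G" "x [^] (p ^ k :: nat) = \<one>"
    by blast
  then show "inv x \<in> {x \<in> carrier G. \<exists>k::nat. x [^] (p ^ k :: nat) = \<one>}"
    by (auto simp: nat_pow_inv)
  assume "y \<in> {x \<in> carrier G. \<exists>k::nat. x [^] (p ^ k :: nat) = \<one>}"
  then obtain l :: nat where l: "y \<in> carrier G" "y [^] (p ^ l :: nat) = \<one>"
    by blast
  have "x [^] (p ^ (k + l) :: nat) = (x [^] (p ^ k :: nat)) [^] (p ^ l :: nat)"
    using k(1) by (simp add: nat_pow_pow power_add)
  moreover have "y [^] (p ^ (k + l) :: nat) = (y [^] (p ^ l :: nat)) [^] (p ^ k :: nat)"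
    using l(1) by (simp add: nat_pow_pow power_add mult.commute)
  ultimately have "(x \<otimes> y) [^] (p ^ (k + l) :: nat) = \<one>"
    using k l by (simp add: nat_pow_distrib)
  with k l show "x \<otimes> y \<in> {x \<in> carrier G. \<exists>k::nat. x [^] (p ^ k :: nat) = \<one>}"
    by blast
qed (auto intro: exI[of _ "\<one>"])

lemma (in comm_group) group_primary_component: "group (primary_component p G)"
  unfolding primary_component_def
  using primary_component_subgroup group_axioms by (rule subgroup.subgroup_is_group)

lemma carrier_primary_component:
  "carrier (primary_component p G) = {x \<in> carrier G. \<exists>k::nat. x [^]\<^bsub>G\<^esub> (p ^ k) = \<one>\<^bsub>G\<^esub>}"
  by (simp add: primary_component_def)

lemma mult_primary_component [simp]: "(\<otimes>\<^bsub>primary_component p G\<^esub>) = (\<otimes>\<^bsub>G\<^esub>)"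
  by (simp add: primary_component_def)

lemma one_primary_component [simp]: "\<one>\<^bsub>primary_component p G\<^esub> = \<one>\<^bsub>G\<^esub>"
  by (simp add: primary_component_def)

text \<open>The map \<open>f\<close> that multiplies all coordinates together is a homomorphism from
  the product of the components to \<open>G\<close>. It is injective because distinct primes give
  coprime exponents, and surjective because Bezout coefficients split an element into factors with
  coprime exponents.\<close>

lemma (in comm_group) primary_decomposition:
  assumes fin: "finite (carrier G)"
  defines "P \<equiv> {p. prime p \<and> p dvd order G}"
  shows "G \<cong> product_group P (\<lambda>p. primary_component p G)"
proof -
  define C where "C = product_group P (\<lambda>p. primary_component p G)"
  define f where "f x = finprod G x P" for x
  have order_pos: "0 < order G"
    using fin by (simp add: order_gt_0_iff_finite)
  then have finP: "finite P"
    unfolding P_def by (auto intro: finite_subset[OF _ finite_divisors_nat])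
  have grpC: "group C"
    by (simp add: C_def group_primary_component)
  have comp: "x p \<in> carrier G" "\<exists>k::nat. x p [^] (p ^ k) = \<one>" if "x \<in> carrier C" "p \<in> P" for x p
    using that by (auto simp: C_def carrier_primary_component PiE_iff)
  have hom: "f \<in> hom C G"
  proof (rule homI)
    fix x y assume xy: "x \<in> carrier C" "y \<in> carrier C"
    then show "f x \<in> carrier G"
      using comp by (auto simp: f_def intro: finprod_closed)
    have "f (x \<otimes>\<^bsub>C\<^esub> y) = finprod G (\<lambda>p. x p \<otimes> y p) P"
      using comp xy unfolding f_def by (intro finprod_cong') (auto simp: C_def)
    also have "\<dots> = f x \<otimes> f y"
      using comp xy unfolding f_def by (intro finprod_multf) auto
    finally show "f (x \<otimes>\<^bsub>C\<^esub> y) = f x \<otimes> f y" .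
  qed
  interpret f: group_hom C G f
    using grpC hom by (simp add: group_hom_def group_hom_axioms_def)
  have "x = \<one>\<^bsub>C\<^esub>" if x: "x \<in> carrier C" and 1: "f x = \<one>" for x
  proof -
    \<comment> \<open>When the product of all coordinates is trivial, \<open>x q\<close> is inverse
      to the product \<open>y\<close> of the others. Hence it is killed by \<open>N\<close>, a
      product of powers of the other primes, as well as by a power of \<open>q\<close>.\<close>
    have "x q = \<one>" if q: "q \<in> P" for q
    proof -
      obtain k :: "nat \<Rightarrow> nat" where k: "x p [^] (p ^ k p) = \<one>" if "p \<in> P" for p
        using comp(2)[OF x] by metis
      define N where "N = (\<Prod>p\<in>P - {q}. p ^ k p)"
      define y where "y = finprod G x (P - {q})"
      have y: "y \<in> carrier G"
        unfolding y_def using comp x by (intro finprod_closed) auto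
      have "y [^] N = \<one>"
        unfolding y_def
      proof (rule finprod_pow_eq_one)
        fix p assume p: "p \<in> P - {q}"
        then have "p ^ k p dvd N"
          unfolding N_def using finP by (intro dvd_prodI) auto
        then obtain m where "N = p ^ k p * m" ..
        with k comp x p show "x p [^] N = \<one>"
          by (simp add: nat_pow_pow[symmetric])
      qed (use finP comp x in auto)
      moreover have "x q \<otimes> y = \<one>"
        using 1 finP q comp[OF x] finprod_insert[of "P - {q}" q x]
        by (auto simp: f_def y_def insert_absorb)
      then have "x q = inv y"
        using comp[OF x q] y by (metis inv_equality)
      ultimately have "x q [^] N = \<one>"
        using y by (simp add: nat_pow_inv)
      moreover have "coprime N (q ^ k q)"
        unfolding N_def using q
        by (intro prod_coprime_left coprime_power_left_iff[THEN iffD2] disjI1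
            coprime_power_right_iff[THEN iffD2] primes_coprime) (auto simp: P_def)
      ultimately show ?thesis
        using pow_coprime_eq_one[OF comp(1)[OF x q] _ k[OF q]] by simp
    qed
    then show ?thesis
      using x by (auto simp: C_def PiE_iff extensional_def fun_eq_iff)
  qed
  then have inj: "inj_on f (carrier C)"
    by (simp add: f.inj_on_one_iff)
  \<comment> \<open>The exponent is generalised from \<open>order G\<close> to any positive
    \<open>n\<close> whose prime divisors lie in \<open>P\<close>, so that induction on
    \<open>n\<close> can remove one prime at a time.\<close>
  have surj: "x \<in> f ` carrier C"
    if "0 < n" "x \<in> carrier G" "x [^] n = \<one>" "\<And>p. prime p \<Longrightarrow> p dvd n \<Longrightarrow> p \<in> P" for x and n :: nat
    using that
  proof (induction n arbitrary: x rule: less_induct)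
    case (less n)
    interpret im: subgroup "f ` carrier C" G
      by (rule f.img_is_subgroup)
    show ?case
    proof (cases "n = 1")
      case True
      with less show ?thesis
        by simp
    next
      case False
      then obtain p where p: "prime p" "p dvd n"
        using prime_factor_nat by blast
      obtain m where m: "n = p ^ multiplicity p n * m" "\<not> p dvd m"
        using multiplicity_decompose'[of n p] p(1) less.prems(1) by (metis not_prime_unit not_gr0)
      define k where "k = multiplicity p n"
      note m = m[folded k_def]
      have "0 < k"
        using p less.prems(1) by (simp add: k_def prime_multiplicity_gt_zero_iff)
      then have "1 < p ^ k"
        using p prime_gt_1_nat[of p] one_less_power[of p k] by simp
      moreover have m_pos: "0 < m"
        using m(1) less.prems(1) by (metis mult_0_right not_gr0)
      ultimately have mn: "m < n"
        using mult_less_mono1[of 1 "p ^ k" m] m(1) by simp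
      have "coprime (int (p ^ k)) (int m)"
        using p m by (simp add: prime_imp_coprime)
      then obtain a b where ab: "a * int (p ^ k) + b * int m = 1"
        using bezout_int[of "int (p ^ k)" "int m"] by auto
      \<comment> \<open>Since \<open>n = p ^ k * m\<close>, the factor \<open>y\<close> is killed by
        \<open>m\<close>, which is smaller than \<open>n\<close>, and falls under the induction
        hypothesis. The factor \<open>z\<close> is killed by \<open>p ^ k\<close> and lies in the
        component at \<open>p\<close>.\<close>
      define y where "y = x [^] (a * int (p ^ k))"
      define z where "z = x [^] (b * int m)"
      have "x = x [^] (a * int (p ^ k) + b * int m)"
        unfolding ab using less.prems(2) by simp
      also have "\<dots> = y \<otimes> z"
        unfolding y_def z_def using less.prems(2) by (rule int_pow_mult)
      finally have yz: "y \<in> carrier G" "z \<in> carrier G" "x = y \<otimes> z"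
        using less.prems(2) by (simp_all add: y_def z_def)
      have xn: "x [^] (int n * c) = \<one>" for c
        using less.prems by (simp add: int_pow_pow[symmetric] int_pow_int)
      have "y [^] m = x [^] (int n * a)" "z [^] (p ^ k) = x [^] (int n * b)"
        using less.prems(2) m(1)
        by (simp_all add: y_def z_def int_pow_int[symmetric] int_pow_pow mult_ac)
      then have ym: "y [^] m = \<one>" and zp: "z [^] (p ^ k) = \<one>"
        by (simp_all add: xn)
      have "y \<in> f ` carrier C"
        using m(1) yz(1) ym less.prems(4) by (intro less.IH[OF mn m_pos]) simp_all
      moreover have "z \<in> f ` carrier C"
      proof
        have pP: "p \<in> P"
          using p less.prems(4) by blast
        have "z \<in> carrier (primary_component p G)"
          using yz(2) zp unfolding carrier_primary_component by blast
        moreover have "\<one> \<in> carrier (primary_component q G)" for q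
          by (simp add: carrier_primary_component)
        ultimately show "(\<lambda>q\<in>P. if p = q then z else \<one>) \<in> carrier C"
          by (simp add: C_def Pi_iff)
        have "f (\<lambda>q\<in>P. if p = q then z else \<one>) = finprod G (\<lambda>q. if p = q then z else \<one>) P"
          unfolding f_def using yz by (intro finprod_cong') auto
        then show "z = f (\<lambda>q\<in>P. if p = q then z else \<one>)"
          using finprod_singleton[OF pP finP, of "\<lambda>_. z"] yz by simp
      qed
      ultimately show ?thesis
        using yz(3) im.m_closed by simp
    qed
  qed
  have "f ` carrier C = carrier G"
  proof
    show "f ` carrier C \<subseteq> carrier G"
      by auto
    \<comment> \<open>Every element is killed by \<open>order G\<close>, whose prime divisors are
      the elements of \<open>P\<close>.\<close>
    show "carrier G \<subseteq> f ` carrier C"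
      using surj[OF order_pos] by (auto simp: P_def pow_order_eq_1)
  qed
  with inj hom have "C \<cong> G"
    by (intro is_isoI isoI) (auto simp: bij_betw_def)
  then show ?thesis
    using group.iso_sym[OF grpC] by (simp add: C_def)
qed

section \<open>Truncated sums and transposition\<close>

text \<open>As \<open>min (v i) k\<close> counts the \<open>j < k\<close> with
  \<open>j < v i\<close>, this is double counting. It turns torsion exponents into partial sums of a
  transposed partition.\<close>

lemma sum_min_eq_sum_card:
  fixes v :: "'a \<Rightarrow> nat"
  assumes "finite I"
  shows "(\<Sum>i\<in>I. min (v i) k) = (\<Sum>j<k. card {i \<in> I. j < v i})"
proof (induction k)
  case (Suc k)
  have "min (v i) (Suc k) = min (v i) k + (if k < v i then 1 else 0)" for i
    by auto
  then have "(\<Sum>i\<in>I. min (v i) (Suc k)) = (\<Sum>i\<in>I. min (v i) k) + card {i \<in> I. k < v i}"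
    using assms by (simp add: sum.distrib sum.inter_filter[symmetric])
  with Suc show ?case
    by simp
qed simp

lemma sum_list_min_eq_sum_length:
  fixes as :: "nat list"
  shows "(\<Sum>a\<leftarrow>as. min a k) = (\<Sum>j<k. length (filter (\<lambda>a. j < a) as))"
proof (induction k)
  case (Suc k)
  have "(\<Sum>a\<leftarrow>as. min a (Suc k)) = (\<Sum>a\<leftarrow>as. min a k) + length (filter (\<lambda>a. k < a) as)"
    by (induction as) auto
  with Suc show ?case
    by simp
qed simp

text \<open>A term is the difference of two consecutive partial sums. In this way equal torsion
  counts for all \<open>k\<close> yield equal individual exponents.\<close>

lemma sum_lessThan_eq_imp_eq:
  fixes f g :: "nat \<Rightarrow> nat"
  assumes "\<And>k. (\<Sum>j<k. f j) = (\<Sum>j<k. g j)"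
  shows "f k = g k"
  using assms[of k] assms[of "Suc k"] by simp

lemma finite_down_closed_eq_lessThan:
  fixes S :: "nat set"
  assumes "finite S" "\<And>i j. j \<in> S \<Longrightarrow> i \<le> j \<Longrightarrow> i \<in> S"
  shows "S = {..<card S}"
proof (cases "S = {}")
  case False
  then have "S = {..Max S}"
    using assms by (auto intro: Max_in)
  then show ?thesis
    by (metis card_atMost lessThan_Suc_atMost)
qed simp

text \<open>A decreasing sequence is determined by its transpose: each \<open>{j. k < f j}\<close>
  is a finite initial segment, hence known from its cardinality, and these sets together determine
  \<open>f\<close>.\<close>

lemma antimono_eqI:
  fixes f g :: "nat \<Rightarrow> nat"
  assumes "antimono f" "antimono g" "\<And>k. finite {j. k < f j}" "\<And>k. finite {j. k < g j}"
    and "\<And>k. card {j. k < f j} = card {j. k < g j}"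
  shows "f = g"
proof -
  have "{j. k < h j} = {..<card {j. k < h j}}" if "antimono h" "finite {j. k < h j}" for h :: "nat \<Rightarrow> nat" and k
    using that(2)
    by (rule finite_down_closed_eq_lessThan) (auto dest: antimonoD[OF that(1)])
  then have *: "{j. k < f j} = {j. k < g j}" for k
    using assms by metis
  have "k < f j \<longleftrightarrow> k < g j" for j k
    using *[of k] by blast
  then show ?thesis
    by (metis linorder_neq_iff less_irrefl ext)
qed

text \<open>The conjugate partition in decreasing order, indexed from 0 and extended by zeros to a
  total function. The strict inequality absorbs the index shift.\<close>

definition transposed_part :: "nat list \<Rightarrow> nat \<Rightarrow> nat" where
  "transposed_part as j = length (filter (\<lambda>a. j < a) as)"

lemma antimono_transposed_part: "antimono (transposed_part as)"
proof (rule antimonoI)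
  fix i j :: nat assume "i \<le> j"
  then show "transposed_part as j \<le> transposed_part as i"
    unfolding transposed_part_def by (induction as) auto
qed

lemma transposed_part_eq_0:
  assumes "Max (set (0 # as)) \<le> j"
  shows "transposed_part as j = 0"
proof -
  have "a \<le> j" if "a \<in> set as" for a
    using assms that by (meson List.finite_set Max_ge le_trans list.set_intros(2))
  then show ?thesis
    by (auto simp: transposed_part_def filter_empty_conv not_less)
qed

lemma finite_transposed_part: "finite {j. k < transposed_part as j}"
proof (rule finite_subset)
  show "{j. k < transposed_part as j} \<subseteq> {..<Max (set (0 # as))}"
    using transposed_part_eq_0[of as] by (metis (mono_tags, lifting) lessThan_iff mem_Collect_eq not_less not_less_zero subsetI)
qed simp

text \<open>The list \<open>conjugate_partition as\<close> consists of the values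
  \<open>transposed_part as j\<close> for \<open>j\<close> below the largest part, and counting its
  entries above \<open>k\<close> does not depend on their order.\<close>

lemma transposed_part_conjugate_partition:
  "transposed_part (conjugate_partition as) k = card {j. k < transposed_part as j}"
proof -
  define M where "M = Max (set (0 # as))"
  have "transposed_part (conjugate_partition as) k =
      length (filter (\<lambda>j. k < length (filter (\<lambda>a. j \<le> a) as)) [1..<Suc M])"
    by (simp add: transposed_part_def conjugate_partition_def M_def filter_map comp_def
        rev_filter[symmetric] del: upt_Suc)
  \<comment> \<open>Starting at 0 instead of 1 turns the \<open>\<le>\<close> of
    \<open>conjugate_partition\<close> into the \<open><\<close> of
    \<open>transposed_part\<close>.\<close>
  also have "[1..<Suc M] = map Suc [0..<M]"
    by (simp add: map_Suc_upt del: upt_Suc)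
  also have "length (filter (\<lambda>j. k < length (filter (\<lambda>a. j \<le> a) as)) \<dots>) =
      length (filter (\<lambda>j. k < transposed_part as j) [0..<M])"
  proof -
    have "(\<le>) (Suc j) = (<) j" for j
      by (simp add: fun_eq_iff Suc_le_eq)
    then show ?thesis
      by (simp add: filter_map comp_def transposed_part_def)
  qed
  also have "\<dots> = card {j \<in> {0..<M}. k < transposed_part as j}"
    by (subst distinct_card[symmetric]) (auto intro: arg_cong[where f = card])
  also have "{j \<in> {0..<M}. k < transposed_part as j} = {j. k < transposed_part as j}"
    using transposed_part_eq_0[of as] unfolding M_def by (auto intro: ccontr simp: not_less)
  finally show ?thesis .
qed

section \<open>Torsion counts of sums of cyclic groups\<close>

lemma gcd_prime_power:
  fixes n p :: nat
  assumes "prime p" "0 < n"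
  shows "gcd n (p ^ k) = p ^ min (multiplicity p n) k"
proof -
  obtain j where j: "gcd n (p ^ k) = p ^ j"
    using divides_primepow_nat[OF assms(1)] gcd_dvd2[of n "p ^ k"] by auto
  have "multiplicity p (gcd n (p ^ k)) = min (multiplicity p n) k"
    using assms by (subst multiplicity_gcd) (auto simp: not_prime_unit)
  with j assms(1) show ?thesis
    by simp
qed

lemma prod_gcd_prime_power:
  fixes f :: "'a \<Rightarrow> nat"
  assumes "prime p" "finite I" "\<And>i. i \<in> I \<Longrightarrow> 0 < f i"
  shows "(\<Prod>i\<in>I. gcd (f i) (p ^ k)) = p ^ (\<Sum>j<k. card {i \<in> I. j < multiplicity p (f i)})"
proof -
  have "(\<Prod>i\<in>I. gcd (f i) (p ^ k)) = p ^ (\<Sum>i\<in>I. min (multiplicity p (f i)) k)"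
    using assms by (simp add: gcd_prime_power power_sum)
  then show ?thesis
    using assms(2) by (simp add: sum_min_eq_sum_card)
qed

section \<open>Conjugate groups and Smith matrices\<close>

lemma torsion_count_cyclic_product:
  assumes "prime p" "finite I" "\<And>i. i \<in> I \<Longrightarrow> 0 < f i"
  shows "torsion_count (product_group I (\<lambda>i. integer_mod_group (f i))) (p ^ k) =
    p ^ (\<Sum>j<k. card {i \<in> I. j < multiplicity p (f i)})"
  using prod_gcd_prime_power[OF assms] assms(2,3)
  by (simp add: torsion_count_product_group torsion_count_integer_mod_group)

lemma group_abelian_p_group [simp]: "group (abelian_p_group p as)"
  by (simp add: abelian_p_group_def)

lemma torsion_count_abelian_p_group:
  assumes "prime p" "prime q"
  shows "torsion_count (abelian_p_group p as) (q ^ k) =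
    (if p = q then q ^ (\<Sum>j<k. transposed_part as j) else 1)"
proof -
  have gcd: "gcd (p ^ a) (q ^ k) = (if p = q then q ^ min a k else 1)" for a
    using assms gcd_prime_power[of p "p ^ a" k] primes_coprime[of p q]
    by (auto simp: prime_gt_0_nat coprime_iff_gcd_eq_1[symmetric])
  have "torsion_count (abelian_p_group p as) (q ^ k) = (\<Prod>i<length as. gcd (p ^ (as ! i)) (q ^ k))"
    using assms
    by (simp add: abelian_p_group_def torsion_count_product_group torsion_count_integer_mod_group
        prime_gt_0_nat)
  also have "\<dots> = (if p = q then q ^ (\<Sum>i<length as. min (as ! i) k) else 1)"
    by (simp add: gcd power_sum)
  also have "(\<Sum>i<length as. min (as ! i) k) = (\<Sum>a\<leftarrow>as. min a k)"
    by (simp add: sum_list_sum_nth atLeast0LessThan)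
  finally show ?thesis
    by (simp add: sum_list_min_eq_sum_length transposed_part_def)
qed

text \<open>Every factor at a prime other than \<open>q\<close> contributes 1. The empty partition
  stands for the trivial component at a prime outside \<open>P\<close>.\<close>

lemma torsion_count_primary_product:
  assumes "finite P" "\<And>p. p \<in> P \<Longrightarrow> prime p" "prime q"
  shows "torsion_count (product_group P (\<lambda>p. abelian_p_group p (t p))) (q ^ k) =
    q ^ (\<Sum>j<k. transposed_part (if q \<in> P then t q else []) j)"
proof -
  have "torsion_count (product_group P (\<lambda>p. abelian_p_group p (t p))) (q ^ k) =
      (\<Prod>p\<in>P. if p = q then q ^ (\<Sum>j<k. transposed_part (t p) j) else 1)"
    unfolding torsion_count_product_group[OF assms(1)]
    using assms(2,3) by (intro prod.cong) (simp_all add: torsion_count_abelian_p_group)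
  then show ?thesis
    using assms(1) by (simp add: transposed_part_def[of "[]"])
qed

lemma (in comm_group) iso_primary_product:
  assumes fin: "finite (carrier G)"
    and t: "\<And>p. prime p \<Longrightarrow> p dvd order G \<Longrightarrow> has_type p (primary_component p G) (t p)"
  shows "G \<cong> product_group {p. prime p \<and> p dvd order G} (\<lambda>p. abelian_p_group p (t p))"
proof -
  have "product_group {p. prime p \<and> p dvd order G} (\<lambda>p. primary_component p G) \<cong>
      product_group {p. prime p \<and> p dvd order G} (\<lambda>p. abelian_p_group p (t p))"
    using t by (intro iso_product_groupI) (auto simp: has_type_def group_primary_component)
  then show ?thesis
    by (rule iso_trans[OF primary_decomposition[OF fin]])
qed

text \<open>One family \<open>t\<close> describes both groups, so at each prime the two counts come
  from a partition and its conjugate.\<close>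

lemma torsion_count_conjugate_group:
  fixes G :: "('a, 'm) monoid_scheme" and G' :: "('b, 'n) monoid_scheme"
  assumes "comm_group G" "finite (carrier G)" "group G'" "is_conjugate_group G G'"
  obtains t where
    "\<And>p k. prime p \<Longrightarrow> torsion_count G (p ^ k) = p ^ (\<Sum>j<k. transposed_part (t p) j)"
    "\<And>p k. prime p \<Longrightarrow>
      torsion_count G' (p ^ k) = p ^ (\<Sum>j<k. transposed_part (conjugate_partition (t p)) j)"
proof -
  interpret comm_group G
    by fact
  define P where "P = {p. prime p \<and> p dvd order G}"
  have "0 < order G"
    using assms(2) by (simp add: order_gt_0_iff_finite)
  then have finP: "finite P"
    unfolding P_def by (auto intro: finite_subset[OF _ finite_divisors_nat])
  have P: "prime p" if "p \<in> P" for p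
    using that by (simp add: P_def)
  obtain t where t: "\<And>p. p \<in> P \<Longrightarrow> has_type p (primary_component p G) (t p)"
    and G': "G' \<cong> product_group P (\<lambda>p. abelian_p_group p (conjugate_partition (t p)))"
    using assms(4) by (auto simp: is_conjugate_group_def Let_def P_def)
  have G: "G \<cong> product_group P (\<lambda>p. abelian_p_group p (t p))"
    using iso_primary_product[OF assms(2)] t by (simp add: P_def)
  have nil: "conjugate_partition [] = []"
    by (simp add: conjugate_partition_def)
  show thesis
  \<comment> \<open>Primes outside \<open>P\<close> receive the empty partition, which is its own
    conjugate; this makes both formulas valid at every prime.\<close>
  proof (rule that[of "\<lambda>q. if q \<in> P then t q else []"])
    fix p k :: nat assume p: "prime p"
    show "torsion_count G (p ^ k) =
        p ^ (\<Sum>j<k. transposed_part (if p \<in> P then t p else []) j)"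
      using torsion_count_iso[OF _ _ G] torsion_count_primary_product[OF finP P p] by simp
    show "torsion_count G' (p ^ k) =
        p ^ (\<Sum>j<k. transposed_part (conjugate_partition (if p \<in> P then t p else [])) j)"
      using torsion_count_iso[OF assms(3) _ G'] torsion_count_primary_product[OF finP P p]
      by (simp add: if_distrib[of conjugate_partition] nil cong: if_cong)
  qed
qed

lemma invariant_factor_pos:
  assumes "\<forall>n\<in>set ns. 0 < n" "i < length ns"
  shows "0 < invariant_factor ns i"
  using assms by (auto simp: invariant_factor_def intro!: prod_pos)

lemma invariant_factor_dvd: "i \<le> j \<Longrightarrow> invariant_factor ns i dvd invariant_factor ns j"
  unfolding invariant_factor_def by (rule prod_dvd_prod_subset) auto

text \<open>
  The invariant factors of the conjugate group, read backwards and localised at a prime \<open>p\<close>,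
  are the numbers \<open>\<bar>G[p ^ Suc j]\<bar> / \<bar>G[p ^ j]\<bar>\<close>: both sides are transposes of the same partition.
\<close>

lemma torsion_count_via_smith_matrix:
  fixes G :: "('a, 'm) monoid_scheme" and G' :: "('b, 'n) monoid_scheme"
  assumes "comm_group G" "finite (carrier G)" "group G'" "is_conjugate_group G G'"
    and ns: "\<forall>n\<in>set ns. 0 < n" "G' \<cong> invariant_factor_group ns" and p: "prime p"
  shows "torsion_count G (p ^ k) = p ^ (\<Sum>j<k. if j < length ns
    then multiplicity p (invariant_factor ns (length ns - Suc j)) else 0)"
proof -
  obtain t where t:
    "\<And>k. torsion_count G (p ^ k) = p ^ (\<Sum>j<k. transposed_part (t p) j)"
    "\<And>k. torsion_count G' (p ^ k) =
      p ^ (\<Sum>j<k. transposed_part (conjugate_partition (t p)) j)"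
    using torsion_count_conjugate_group[OF assms(1-4)] p by metis
  define r where "r = length ns"
  define v where "v i = multiplicity p (invariant_factor ns i)" for i
  \<comment> \<open>The exponents of \<open>p\<close> in the invariant factors, read from the last
    to the first and padded with zeros.\<close>
  define g where "g j = (if j < r then v (r - Suc j) else 0)" for j
  have "torsion_count G' (p ^ k) = p ^ (\<Sum>j<k. card {i \<in> {..<r}. j < v i})" for k
    using torsion_count_iso[OF assms(3) _ ns(2)]
      torsion_count_cyclic_product[OF p, of "{..<r}" "invariant_factor ns" k] ns(1)
    by (simp add: invariant_factor_group_def invariant_factor_pos r_def v_def)
  \<comment> \<open>The two formulas for the torsion of \<open>G'\<close>, one from its conjugate
    types and one from its invariant factors, are compared. It follows that
    \<open>transposed_part (t p)\<close> and \<open>v\<close> exceed each \<open>k\<close> equally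
    often.\<close>
  then have "(\<Sum>j<k. transposed_part (conjugate_partition (t p)) j) =
      (\<Sum>j<k. card {i \<in> {..<r}. j < v i})" for k
    using t(2)[of k] p by (simp add: prime_gt_Suc_0_nat)
  then have card_v: "card {j. k < transposed_part (t p) j} = card {i \<in> {..<r}. k < v i}" for k
    unfolding transposed_part_conjugate_partition by (rule sum_lessThan_eq_imp_eq)
  have g_set: "{j. k < g j} = {j \<in> {..<r}. k < v (r - Suc j)}" for k
    by (auto simp: g_def)
  have "bij_betw (\<lambda>i. r - Suc i) {j. k < g j} {i \<in> {..<r}. k < v i}" for k
    unfolding g_set by (rule bij_betw_byWitness[where f' = "\<lambda>i. r - Suc i"]) auto
  then have card_g: "card {j. k < g j} = card {i \<in> {..<r}. k < v i}" for k
    by (rule bij_betw_same_card)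
  \<comment> \<open>The divisibility chain makes \<open>v\<close> increase, so its reversal
    \<open>g\<close> decreases; being decreasing, \<open>g\<close> is determined by its level
    counts.\<close>
  have "antimono g"
  proof (rule antimonoI)
    fix i j :: nat assume "i \<le> j"
    moreover have "v i \<le> v j" if "i \<le> j" "j < r" for i j
      unfolding v_def using that ns(1) invariant_factor_pos[OF ns(1), of j]
      by (intro dvd_imp_multiplicity_le invariant_factor_dvd) (auto simp: r_def)
    ultimately show "g j \<le> g i"
      by (auto simp: g_def)
  qed
  then have "transposed_part (t p) = g"
    by (intro antimono_eqI antimono_transposed_part finite_transposed_part)
      (simp_all only: card_v card_g, simp_all add: g_set)
  then show ?thesis
    using t(1)[of k] unfolding g_def r_def v_def by simp
qed

text \<open>Diagonal matrices multiply entrywise, and all three matrices are Smith normal forms by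
  construction.\<close>

lemma snf_factorisation_iff:
  assumes "\<forall>n\<in>set ns. 0 < n" "\<forall>n\<in>set ms. 0 < n" "\<forall>n\<in>set ls. 0 < n"
    and "length ns = r" "length ms = r" "length ls = r"
  shows "snf_factorisation (invariant_factor_mat ns) [invariant_factor_mat ms, invariant_factor_mat ls]
    \<longleftrightarrow> (\<forall>i<r. invariant_factor ns i = invariant_factor ms i * invariant_factor ls i)"
proof -
  have diag: "mat_diag r f = mat_diag r g \<longleftrightarrow> (\<forall>i<r. f i = g i)" for f g :: "nat \<Rightarrow> int"
    by (auto simp: mat_diag_def mat_eq_iff)
  have dim: "dim_row (mat_diag r f) = r" for f :: "nat \<Rightarrow> int"
    by (simp add: mat_diag_def)
  have "smith_normal_form (invariant_factor_mat xs)" if "\<forall>n\<in>set xs. 0 < n" for xs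
    using that by (auto simp: smith_normal_form_def)
  with assms have "snf_factorisation (invariant_factor_mat ns)
      [invariant_factor_mat ms, invariant_factor_mat ls] \<longleftrightarrow>
    mat_diag r (\<lambda>i. int (invariant_factor ns i)) =
      mat_diag r (\<lambda>i. int (invariant_factor ms i) * int (invariant_factor ls i))"
    by (simp add: snf_factorisation_def) (simp add: invariant_factor_mat_def dim right_mult_one_mat[OF mat_diag_dim])
  then show ?thesis
    by (simp add: diag of_nat_mult[symmetric] del: of_nat_mult)
qed

section \<open>Recovering a product of cyclic groups from its torsion counts\<close>

lemma primepow_eq_iff:
  fixes n p :: nat
  assumes "prime p" "primepow n"
  shows "n = p ^ Suc k \<longleftrightarrow> multiplicity p n = Suc k"
proof -
  obtain q l where q: "prime q" "n = q ^ Suc l"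
    using assms(2) by (auto simp: primepow_def gr0_conv_Suc)
  show ?thesis
  proof (cases "p = q")
    case True
    then show ?thesis
      using q multiplicity_prime_power[of p "Suc l"] by (auto simp: prime_gt_Suc_0_nat simp del: power_Suc)
  next
    case False
    \<comment> \<open>For a power of another prime both sides fail. The exponent
      \<open>Suc k\<close> matters: multiplicity 0 would say nothing about \<open>n\<close>.\<close>
    then have "\<not> p dvd n"
      using q assms(1) by (metis prime_dvd_power primes_dvd_imp_eq)
    then show ?thesis
      by (auto simp: not_dvd_imp_multiplicity_0)
  qed
qed

text \<open>The number of factors of order exactly \<open>p ^ Suc k\<close> is a difference of two
  tail counts, stated additively to avoid subtraction in \<open>nat\<close>.\<close>

lemma card_primepow_fibre:
  fixes f :: "'a \<Rightarrow> nat"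
  assumes "prime p" "finite I" "\<And>i. i \<in> I \<Longrightarrow> primepow (f i)"
  shows "card {i \<in> I. f i = p ^ Suc k} + card {i \<in> I. Suc k < multiplicity p (f i)} =
    card {i \<in> I. k < multiplicity p (f i)}"
proof -
  have "{i \<in> I. f i = p ^ Suc k} = {i \<in> I. multiplicity p (f i) = Suc k}"
    using primepow_eq_iff[OF assms(1,3)] by blast
  moreover have "{i \<in> I. k < multiplicity p (f i)} =
      {i \<in> I. multiplicity p (f i) = Suc k} \<union> {i \<in> I. Suc k < multiplicity p (f i)}"
    by auto
  ultimately show ?thesis
    using assms(2) by (subst card_Un_disjoint[symmetric]) auto
qed

text \<open>Torsion counts determine the tail counts, these determine how many factors have each
  prime power order, and factors of equal order can be matched.\<close>

lemma cyclic_products_iso: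
  fixes f :: "'a \<Rightarrow> nat" and g :: "'b \<Rightarrow> nat"
  assumes fin: "finite I" "finite J"
    and pp: "\<And>i. i \<in> I \<Longrightarrow> primepow (f i)" "\<And>j. j \<in> J \<Longrightarrow> primepow (g j)"
    and tc: "\<And>p k. prime p \<Longrightarrow>
      torsion_count (product_group I (\<lambda>i. integer_mod_group (f i))) (p ^ k) =
      torsion_count (product_group J (\<lambda>j. integer_mod_group (g j))) (p ^ k)"
  shows "product_group I (\<lambda>i. integer_mod_group (f i)) \<cong>
    product_group J (\<lambda>j. integer_mod_group (g j))"
proof -
  have eq: "card {i \<in> I. k < multiplicity p (f i)} = card {j \<in> J. k < multiplicity p (g j)}"
    if p: "prime p" for p k
  proof -
    have "(\<Sum>j<k. card {i \<in> I. j < multiplicity p (f i)}) =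
        (\<Sum>j<k. card {i \<in> J. j < multiplicity p (g i)})" for k
      using tc[OF p, of k] p fin pp
      by (simp add: torsion_count_cyclic_product primepow_gt_0_nat prime_gt_Suc_0_nat)
    then show ?thesis
      by (rule sum_lessThan_eq_imp_eq)
  qed
  have "card {j \<in> J. g j = n} = card {i \<in> I. f i = n}" for n
  proof (cases "primepow n")
    case True
    then obtain p k where "prime p" "n = p ^ Suc k"
      by (auto simp: primepow_def gr0_conv_Suc)
    then show ?thesis
      using card_primepow_fibre[of p I f k] card_primepow_fibre[of p J g k] eq fin pp
      by simp
  next
    case False
    then have "{j \<in> J. g j = n} = {}" "{i \<in> I. f i = n} = {}"
      using pp by auto
    then show ?thesis
      by (simp only: card.empty)
  qed
  then obtain h where "bij_betw h J I" "\<forall>j\<in>J. f (h j) = g j"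
    using exists_bij_betw_preserving[of J I g f] fin by blast
  then show ?thesis
    by (intro product_group_reindex) auto
qed

text \<open>The types provided by \<open>is_conjugate_group\<close> split the primary components
  into cyclic groups; with the primary decomposition this splits \<open>G\<close> itself.\<close>

lemma iso_cyclic_product:
  fixes G :: "('a, 'm) monoid_scheme"
  assumes "comm_group G" "finite (carrier G)" "is_conjugate_group G G'"
  obtains I :: "(nat \<times> nat) set" and f where "finite I" "\<And>i. i \<in> I \<Longrightarrow> primepow (f i)"
    "G \<cong> product_group I (\<lambda>i. integer_mod_group (f i))"
proof -
  interpret comm_group G
    by fact
  define P where "P = {p. prime p \<and> p dvd order G}"
  have "0 < order G"
    using assms(2) by (simp add: order_gt_0_iff_finite)
  then have finP: "finite P"
    unfolding P_def by (auto intro: finite_subset[OF _ finite_divisors_nat])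
  obtain t where t: "\<And>p. p \<in> P \<Longrightarrow> has_type p (primary_component p G) (t p)"
    using assms(3) by (auto simp: is_conjugate_group_def Let_def P_def)
  define S where "S = Sigma P (\<lambda>p. {..<length (t p)})"
  define f where "f = (\<lambda>(p, i). p ^ (t p ! i))"
  \<comment> \<open>Zero parts give factors of order 1, which is not a prime power, so their indices
    are removed.\<close>
  define I where "I = {s \<in> S. f s \<noteq> 1}"
  have finS: "finite S"
    using finP by (simp add: S_def)
  have "product_group S (\<lambda>s. integer_mod_group (f s)) \<cong>
      product_group P (\<lambda>p. abelian_p_group p (t p))"
    using product_group_Sigma[of P "\<lambda>p. {..<length (t p)}" "\<lambda>p i. integer_mod_group (p ^ (t p ! i))"]
    by (simp add: S_def f_def abelian_p_group_def case_prod_unfold)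
  moreover have "G \<cong> product_group P (\<lambda>p. abelian_p_group p (t p))"
    using iso_primary_product[OF assms(2)] t by (simp add: P_def)
  ultimately have "G \<cong> product_group S (\<lambda>s. integer_mod_group (f s))"
    by (meson group.iso_sym group_integer_mod_group product_group iso_trans)
  also have "\<dots> \<cong> product_group I (\<lambda>s. integer_mod_group (f s))"
    by (rule product_group_drop_trivial) (auto simp: I_def trivial_integer_mod_group)
  finally have "G \<cong> product_group I (\<lambda>s. integer_mod_group (f s))" .
  moreover have "primepow (f s)" if "s \<in> I" for s
  proof -
    obtain p i where "s = (p, i)"
      by (cases s)
    with that have "prime p" "f s = p ^ (t p ! i)" "p ^ (t p ! i) \<noteq> 1"
      by (simp_all add: I_def S_def P_def f_def)
    moreover from this have "0 < t p ! i"
      by (metis power_0 not_gr0)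
    ultimately show ?thesis
      unfolding primepow_def by blast
  qed
  moreover have "finite I"
    using finS by (simp add: I_def)
  ultimately show thesis
    using that by blast
qed

text \<open>One direction is multiplicativity of torsion counts. For the other, both sides are
  written as products of cyclic groups of prime power order and then compared.\<close>

lemma iso_DirProd_iff_torsion_count:
  fixes G :: "('a, 'm) monoid_scheme" and H :: "('b, 'n) monoid_scheme"
    and K :: "('c, 'k) monoid_scheme"
  assumes "comm_group G" "finite (carrier G)" "is_conjugate_group G G'"
    and "comm_group H" "finite (carrier H)" "is_conjugate_group H H'"
    and "comm_group K" "finite (carrier K)" "is_conjugate_group K K'"
  shows "G \<cong> H \<times>\<times> K \<longleftrightarrow> (\<forall>p k. prime p \<longrightarrow>
    torsion_count G (p ^ k) = torsion_count H (p ^ k) * torsion_count K (p ^ k))"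
proof -
  have grp: "group G" "group H" "group K"
    using assms by (simp_all add: comm_group.axioms)
  obtain I :: "(nat \<times> nat) set" and f where I: "finite I" "\<And>i. i \<in> I \<Longrightarrow> primepow (f i)"
    "G \<cong> product_group I (\<lambda>i. integer_mod_group (f i))"
    by (rule iso_cyclic_product[OF assms(1-3)]) blast
  obtain A :: "(nat \<times> nat) set" and a where A: "finite A" "\<And>i. i \<in> A \<Longrightarrow> primepow (a i)"
    "H \<cong> product_group A (\<lambda>i. integer_mod_group (a i))"
    by (rule iso_cyclic_product[OF assms(4-6)]) blast
  obtain B :: "(nat \<times> nat) set" and b where B: "finite B" "\<And>i. i \<in> B \<Longrightarrow> primepow (b i)"
    "K \<cong> product_group B (\<lambda>i. integer_mod_group (b i))"
    by (rule iso_cyclic_product[OF assms(7-9)]) blast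
  let ?G = "product_group I (\<lambda>i. integer_mod_group (f i))"
  \<comment> \<open>Indexing by a disjoint sum presents \<open>H \<times>\<times> K\<close> as one
    product of cyclic groups, the form that \<open>cyclic_products_iso\<close> compares.\<close>
  let ?HK = "product_group (A <+> B) (\<lambda>i. integer_mod_group (case_sum a b i))"
  have "case_sum (\<lambda>i. integer_mod_group (a i)) (\<lambda>i. integer_mod_group (b i)) =
      (\<lambda>i. integer_mod_group (case_sum a b i))"
    by (simp add: fun_eq_iff split: sum.split)
  then have "?HK \<cong> product_group A (\<lambda>i. integer_mod_group (a i)) \<times>\<times>
      product_group B (\<lambda>i. integer_mod_group (b i))"
    using product_group_Plus[of A B "\<lambda>i. integer_mod_group (a i)" "\<lambda>i. integer_mod_group (b i)"]
    by simp
  moreover have "H \<times>\<times> K \<cong> product_group A (\<lambda>i. integer_mod_group (a i)) \<times>\<times>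
      product_group B (\<lambda>i. integer_mod_group (b i))"
    using DirProd_is_iso_cong[OF grp(2,3) A(3) B(3)] .
  ultimately have HK: "?HK \<cong> H \<times>\<times> K"
    using grp by (meson DirProd_group group.iso_sym iso_trans)
  show ?thesis
  proof
    assume "G \<cong> H \<times>\<times> K"
    then show "\<forall>p k. prime p \<longrightarrow>
        torsion_count G (p ^ k) = torsion_count H (p ^ k) * torsion_count K (p ^ k)"
      using grp by (auto simp: torsion_count_DirProd DirProd_group dest: torsion_count_iso[rotated 2])
  next
    assume tc: "\<forall>p k. prime p \<longrightarrow>
      torsion_count G (p ^ k) = torsion_count H (p ^ k) * torsion_count K (p ^ k)"
    have "?G \<cong> ?HK"
    proof (rule cyclic_products_iso)
      fix p k :: nat assume "prime p"
      then show "torsion_count ?G (p ^ k) = torsion_count ?HK (p ^ k)"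
        using tc torsion_count_iso[OF grp(1) _ I(3), of "p ^ k"]
          torsion_count_iso[OF _ DirProd_group[OF grp(2,3)] HK, of "p ^ k"]
        by (simp add: torsion_count_DirProd)
    qed (use I A B in auto)
    with I(3) HK show "G \<cong> H \<times>\<times> K"
      by (blast intro: iso_trans)
  qed
qed

section \<open>Smith factorisations and direct factorisations compared prime by prime\<close>

theorem proposition1:
  fixes G :: "('a, 'm) monoid_scheme" and H :: "('b, 'n) monoid_scheme"
    and K :: "('c, 'k) monoid_scheme"
    and G' :: "('d, 'p) monoid_scheme" and H' :: "('e, 'q) monoid_scheme"
    and K' :: "('f, 's) monoid_scheme"
    and MG' MH' MK' :: "int mat" and r :: nat
  assumes "comm_group G" "finite (carrier G)"
    and "comm_group H" "finite (carrier H)"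
    and "comm_group K" "finite (carrier K)"
    and "comm_group G'" "finite (carrier G')" "is_conjugate_group G G'"
    and "comm_group H'" "finite (carrier H')" "is_conjugate_group H H'"
    and "comm_group K'" "finite (carrier K')" "is_conjugate_group K K'"
    and "is_smith_matrix_of r G' MG'"
    and "is_smith_matrix_of r H' MH'"
    and "is_smith_matrix_of r K' MK'"
  shows "snf_factorisation MG' [MH', MK'] \<longleftrightarrow> G \<cong> H \<times>\<times> K"
proof -
  obtain ns where ns: "length ns = r" "\<forall>n\<in>set ns. 0 < n" "G' \<cong> invariant_factor_group ns"
    "MG' = invariant_factor_mat ns"
    using \<open>is_smith_matrix_of r G' MG'\<close> by (auto simp: is_smith_matrix_of_def)
  obtain ms where ms: "length ms = r" "\<forall>n\<in>set ms. 0 < n" "H' \<cong> invariant_factor_group ms"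
    "MH' = invariant_factor_mat ms"
    using \<open>is_smith_matrix_of r H' MH'\<close> by (auto simp: is_smith_matrix_of_def)
  obtain ls where ls: "length ls = r" "\<forall>n\<in>set ls. 0 < n" "K' \<cong> invariant_factor_group ls"
    "MK' = invariant_factor_mat ls"
    using \<open>is_smith_matrix_of r K' MK'\<close> by (auto simp: is_smith_matrix_of_def)
  let ?v = "\<lambda>p xs j. if j < r then multiplicity p (invariant_factor xs (r - Suc j)) else 0"
  have grp: "group G'" "group H'" "group K'"
    using assms by (simp_all add: comm_group.axioms)
  have tc: "torsion_count G (p ^ k) = p ^ (\<Sum>j<k. ?v p ns j)"
    "torsion_count H (p ^ k) = p ^ (\<Sum>j<k. ?v p ms j)"
    "torsion_count K (p ^ k) = p ^ (\<Sum>j<k. ?v p ls j)" if "prime p" for p k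
    using torsion_count_via_smith_matrix[OF assms(1,2) grp(1) assms(9) ns(2,3) that, unfolded ns(1)]
      torsion_count_via_smith_matrix[OF assms(3,4) grp(2) assms(12) ms(2,3) that, unfolded ms(1)]
      torsion_count_via_smith_matrix[OF assms(5,6) grp(3) assms(15) ls(2,3) that, unfolded ls(1)]
    by this+
  have sums_iff: "(\<forall>j. f j = g j) \<longleftrightarrow> (\<forall>k. (\<Sum>j<k. f j) = (\<Sum>j<k. g j))" for f g :: "nat \<Rightarrow> nat"
    using sum_lessThan_eq_imp_eq[of f g] by auto
  have pos: "0 < invariant_factor xs i" if "xs \<in> {ns, ms, ls}" "i < r" for xs i
    using that ns ms ls by (auto intro: invariant_factor_pos)
  have "snf_factorisation MG' [MH', MK'] \<longleftrightarrow>
      (\<forall>i<r. invariant_factor ns i = invariant_factor ms i * invariant_factor ls i)"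
    unfolding ns(4) ms(4) ls(4) by (rule snf_factorisation_iff) (fact ns(1,2) ms(1,2) ls(1,2))+
  \<comment> \<open>Positive integers agree if and only if their multiplicities at all primes do,
    and multiplicities turn products into sums.\<close>
  also have "\<dots> \<longleftrightarrow> (\<forall>i<r. \<forall>p. prime p \<longrightarrow> multiplicity p (invariant_factor ns i) =
      multiplicity p (invariant_factor ms i) + multiplicity p (invariant_factor ls i))"
  proof (intro all_cong)
    fix i assume i: "i < r"
    have "multiplicity p (invariant_factor ms i * invariant_factor ls i) =
        multiplicity p (invariant_factor ms i) + multiplicity p (invariant_factor ls i)"
      if "prime p" for p
      using that pos[of ms i] pos[of ls i] i by (intro prime_elem_multiplicity_mult_distrib) auto
    then show "invariant_factor ns i = invariant_factor ms i * invariant_factor ls i \<longleftrightarrow>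
        (\<forall>p. prime p \<longrightarrow> multiplicity p (invariant_factor ns i) =
          multiplicity p (invariant_factor ms i) + multiplicity p (invariant_factor ls i))"
      using pos i by (metis insertCI multiplicity_eq_nat nat_0_less_mult_iff)
  qed
  \<comment> \<open>Only the indexing changes: positions are reversed, and beyond \<open>r\<close>
    the equation reads \<open>0 = 0 + 0\<close>.\<close>
  also have "\<dots> \<longleftrightarrow> (\<forall>p. prime p \<longrightarrow> (\<forall>j. ?v p ns j = ?v p ms j + ?v p ls j))"
  proof (intro iffI allI impI)
    fix p i :: nat
    assume *: "\<forall>p. prime p \<longrightarrow> (\<forall>j. ?v p ns j = ?v p ms j + ?v p ls j)" and "i < r" "prime p"
    then show "multiplicity p (invariant_factor ns i) =
        multiplicity p (invariant_factor ms i) + multiplicity p (invariant_factor ls i)"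
      using *[rule_format, of p "r - Suc i"] by simp
  qed simp
  \<comment> \<open>Passing to partial sums produces the exponents in \<open>tc\<close>; as
    \<open>p\<close> exceeds 1, adding exponents is the same as multiplying torsion counts.\<close>
  also have "\<dots> \<longleftrightarrow> (\<forall>p. prime p \<longrightarrow>
      (\<forall>k. (\<Sum>j<k. ?v p ns j) = (\<Sum>j<k. ?v p ms j) + (\<Sum>j<k. ?v p ls j)))"
    by (simp only: sums_iff[of "?v p ns" "\<lambda>j. ?v p ms j + ?v p ls j" for p, unfolded sum.distrib])
  also have "\<dots> \<longleftrightarrow> (\<forall>p k. prime p \<longrightarrow>
      torsion_count G (p ^ k) = torsion_count H (p ^ k) * torsion_count K (p ^ k))"
    by (auto simp: tc prime_gt_Suc_0_nat simp flip: power_add)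
  also have "\<dots> \<longleftrightarrow> G \<cong> H \<times>\<times> K"
    by (rule iso_DirProd_iff_torsion_count[symmetric]) (fact assms)+
  finally show ?thesis .
qed

end
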